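(* Let $P,Q\in\mathbb P_d$ and $t\in[0,1]$, and put $R_1:=\big[\gamma^{\mathrm{BW}}_{P^{-1}Q}(t)\big]^{-1}$ and $R_2:=\big[\gamma^{\mathrm{BW}}_{Q^{-1}P}(t)\big]^{-1}$. Then $\operatorname{F}_{R_1}(P,Q)=\operatorname{F}_{R_2}(P,Q)$.
   Context: $\mathbb P_d$ is the set of $d\times d$ complex positive definite matrices; $A\#B:=A^{1/2}(A^{-1/2}BA^{-1/2})^{1/2}A^{1/2}$. The Bures–Wasserstein geodesic between $A,B\in\mathbb P_d$ is $\gamma^{\mathrm{BW}}_{AB}(t):=[(1-t)\mathbb I+t\,A^{-1}\#B]\,A\,[(1-t)\mathbb I+t\,A^{-1}\#B]$, $t\in[0,1]$. The generalized fidelity is $\operatorname{F}_R(P,Q):=\operatorname{Tr}\big[\sqrt{R^{1/2}PR^{1/2}}\,R^{-1}\sqrt{R^{1/2}QR^{1/2}}\big]$. *)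

theory Defs
  imports "Jordan_Normal_Form.Matrix"
begin

definition cadj :: "complex mat \<Rightarrow> complex mat" where
  "cadj A = mat (dim_col A) (dim_row A) (\<lambda>(i,j). cnj (A $$ (j,i)))"

definition mtrace :: "complex mat \<Rightarrow> complex" where
  "mtrace A = (\<Sum>i<dim_row A. A $$ (i,i))"

definition hermitian :: "complex mat \<Rightarrow> bool" where
  "hermitian A \<longleftrightarrow> cadj A = A"

definition quad_form :: "complex mat \<Rightarrow> complex vec \<Rightarrow> complex" where
  "quad_form A v = (\<Sum>i<dim_vec v. cnj (v $ i) * (A *\<^sub>v v) $ i)"

definition pos_def :: "nat \<Rightarrow> complex mat \<Rightarrow> bool" where
  "pos_def d A \<longleftrightarrow> A \<in> carrier_mat d d \<and> hermitian A \<and>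
     (\<forall>v \<in> carrier_vec d. v \<noteq> 0\<^sub>v d \<longrightarrow> Re (quad_form A v) > 0)"

definition pos_semidef :: "nat \<Rightarrow> complex mat \<Rightarrow> bool" where
  "pos_semidef d A \<longleftrightarrow> A \<in> carrier_mat d d \<and> hermitian A \<and>
     (\<forall>v \<in> carrier_vec d. Re (quad_form A v) \<ge> 0)"

definition minv :: "nat \<Rightarrow> complex mat \<Rightarrow> complex mat" where
  "minv d A = (THE B. B \<in> carrier_mat d d \<and> A * B = 1\<^sub>m d \<and> B * A = 1\<^sub>m d)"

definition msqrt :: "nat \<Rightarrow> complex mat \<Rightarrow> complex mat" where
  "msqrt d A = (THE B. pos_semidef d B \<and> B * B = A)"

definition gmean :: "nat \<Rightarrow> complex mat \<Rightarrow> complex mat \<Rightarrow> complex mat" where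
  "gmean d A B = msqrt d A * msqrt d (minv d (msqrt d A) * B * minv d (msqrt d A)) * msqrt d A"

definition bw_geod :: "nat \<Rightarrow> complex mat \<Rightarrow> complex mat \<Rightarrow> real \<Rightarrow> complex mat" where
  "bw_geod d A B t =
    (let M = complex_of_real (1 - t) \<cdot>\<^sub>m 1\<^sub>m d + complex_of_real t \<cdot>\<^sub>m gmean d (minv d A) B
     in M * A * M)"

definition gen_fid :: "nat \<Rightarrow> complex mat \<Rightarrow> complex mat \<Rightarrow> complex mat \<Rightarrow> complex" where
  "gen_fid d R P Q = mtrace (msqrt d (msqrt d R * P * msqrt d R) * minv d R *
                            msqrt d (msqrt d R * Q * msqrt d R))"

end

theory Submission
  imports Defs "Jordan_Normal_Form.Schur_Decomposition"
begin

text \<open>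
  Put \<open>M = (1 - t) I + t (P # Q)\<close>. As \<open>P # Q = Q # P\<close>, both geodesics are conjugations by the
  same \<open>M\<close>, and \<open>R1 = M\<inverse> P M\<inverse>\<close>, \<open>R2 = M\<inverse> Q M\<inverse>\<close>. If \<open>X\<close> and \<open>Y\<close> are the positive definite
  solutions of the Riccati equations \<open>X R X = P\<close> and \<open>Y R Y = Q\<close>, then the fidelity is
  \<open>Tr (X Y R)\<close>. For \<open>R1\<close> the first solution is \<open>M\<close>; for \<open>R2\<close> the second one is \<open>M\<close>. If \<open>X\<close> denotes
  the first solution for \<open>R2\<close>, then \<open>M X\<inverse> M\<close> is the second one for \<open>R1\<close>, and cyclicity of
  the trace identifies the two fidelities.
\<close>

section \<open>Adjoints, quadratic forms and traces\<close>

lemma cadj_carrier [simp]: "A \<in> carrier_mat n m \<Longrightarrow> cadj A \<in> carrier_mat m n"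
  by (auto simp: cadj_def)

lemma cadj_cadj [simp]: "cadj (cadj A) = A"
  by (auto simp: cadj_def)

lemma cadj_index [simp]: "i < dim_col A \<Longrightarrow> j < dim_row A \<Longrightarrow> cadj A $$ (i, j) = cnj (A $$ (j, i))"
  by (simp add: cadj_def)

lemma cadj_dim [simp]: "dim_row (cadj A) = dim_col A" "dim_col (cadj A) = dim_row A"
  by (auto simp: cadj_def)

lemma cadj_mult: "A \<in> carrier_mat n m \<Longrightarrow> B \<in> carrier_mat m k \<Longrightarrow> cadj (A * B) = cadj B * cadj A"
  by (intro eq_matI) (auto simp: scalar_prod_def mult.commute)

lemma cadj_one [simp]: "cadj (1\<^sub>m n) = 1\<^sub>m n"
  by (intro eq_matI) auto

lemma pos_defD:
  assumes "pos_def d A"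
  shows "A \<in> carrier_mat d d" "cadj A = A"
    "\<And>v. v \<in> carrier_vec d \<Longrightarrow> v \<noteq> 0\<^sub>v d \<Longrightarrow> Re (quad_form A v) > 0"
  using assms by (auto simp: pos_def_def hermitian_def)

lemma quad_form_zero [simp]: "A \<in> carrier_mat d d \<Longrightarrow> quad_form A (0\<^sub>v d) = 0"
  by (simp add: quad_form_def)

lemma pos_def_imp_semidef: "pos_def d A \<Longrightarrow> pos_semidef d A"
  unfolding pos_def_def pos_semidef_def
  by (metis order.strict_implies_order order.refl quad_form_zero zero_complex.sel(1))

lemma quad_form_eq_scalar_prod:
  "dim_row A = dim_vec v \<Longrightarrow> quad_form A v = conjugate v \<bullet> (A *\<^sub>v v)"
  by (auto simp: quad_form_def scalar_prod_def lessThan_atLeast0 intro!: sum.cong)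

lemma scalar_prod_cadj:
  assumes B: "B \<in> carrier_mat n m" and u: "u \<in> carrier_vec m" and w: "w \<in> carrier_vec n"
  shows "conjugate u \<bullet> (cadj B *\<^sub>v w) = conjugate (B *\<^sub>v u) \<bullet> w"
proof -
  have "conjugate u \<bullet> (cadj B *\<^sub>v w) = (\<Sum>i<m. \<Sum>k<n. cnj (u $ i) * cnj (B $$ (k, i)) * w $ k)"
    using assms
    by (auto simp: scalar_prod_def lessThan_atLeast0 sum_distrib_left mult.assoc intro!: sum.cong)
  also have "\<dots> = (\<Sum>k<n. \<Sum>i<m. cnj (u $ i) * cnj (B $$ (k, i)) * w $ k)"
    by (rule sum.swap)
  also have "\<dots> = conjugate (B *\<^sub>v u) \<bullet> w"
    using assms
    by (auto simp: scalar_prod_def lessThan_atLeast0 sum_distrib_right sum_distrib_left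
        mult.commute intro!: sum.cong)
  finally show ?thesis .
qed

lemma quad_form_congruence:
  assumes A: "A \<in> carrier_mat n n" and B: "B \<in> carrier_mat n m" and v: "v \<in> carrier_vec m"
  shows "quad_form (cadj B * A * B) v = quad_form A (B *\<^sub>v v)"
proof -
  have "(cadj B * A * B) *\<^sub>v v = cadj B *\<^sub>v (A *\<^sub>v (B *\<^sub>v v))"
    using assms
    by (simp add: assoc_mult_mat[of _ m n _ n _ m] assoc_mult_mat_vec[of _ m n _ m]
        assoc_mult_mat_vec[of _ n n _ m])
  then show ?thesis
    using assms scalar_prod_cadj[OF B v, of "A *\<^sub>v (B *\<^sub>v v)"]
    by (simp add: quad_form_eq_scalar_prod)
qed

lemma cadj_congruence:
  assumes "A \<in> carrier_mat n n" "cadj A = A" "B \<in> carrier_mat n m"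
  shows "cadj (cadj B * A * B) = cadj B * A * B"
  using assms by (simp add: cadj_mult[of _ m n _ m] cadj_mult[of _ n n _ m] assoc_mult_mat[of _ m n _ n _ m])

text \<open>The left inverse \<open>C\<close> makes \<open>B\<close> injective, so the form of
  \<open>A\<close> is evaluated only at nonzero vectors \<open>B *\<^sub>v v\<close>.\<close>

lemma pos_def_congruence:
  assumes A: "pos_def d A" and B: "B \<in> carrier_mat d d" and C: "C \<in> carrier_mat d d"
    and CB: "C * B = 1\<^sub>m d"
  shows "pos_def d (cadj B * A * B)"
proof -
  have "B *\<^sub>v v \<noteq> 0\<^sub>v d" if "v \<in> carrier_vec d" "v \<noteq> 0\<^sub>v d" for v
  proof
    assume "B *\<^sub>v v = 0\<^sub>v d"
    then have "(C * B) *\<^sub>v v = 0\<^sub>v d"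
      using B C that by (auto simp: assoc_mult_mat_vec[of _ d d _ d] scalar_prod_def intro!: eq_vecI)
    then show False
      using that CB by simp
  qed
  then show ?thesis
    using pos_defD[OF A] B
    by (auto simp: pos_def_def hermitian_def cadj_congruence[of _ d] quad_form_congruence)
qed

lemma mtrace_comm:
  assumes "A \<in> carrier_mat n m" "B \<in> carrier_mat m n"
  shows "mtrace (A * B) = mtrace (B * A)"
proof -
  have "mtrace (A * B) = (\<Sum>i<n. \<Sum>k<m. A $$ (i, k) * B $$ (k, i))"
    using assms by (auto simp: mtrace_def scalar_prod_def lessThan_atLeast0 intro!: sum.cong)
  also have "\<dots> = (\<Sum>k<m. \<Sum>i<n. B $$ (k, i) * A $$ (i, k))"
    by (subst sum.swap) (simp add: mult.commute)
  also have "\<dots> = mtrace (B * A)"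
    using assms by (auto simp: mtrace_def scalar_prod_def lessThan_atLeast0 intro!: sum.cong)
  finally show ?thesis .
qed

lemma mtrace_add:
  "A \<in> carrier_mat n n \<Longrightarrow> B \<in> carrier_mat n n \<Longrightarrow> mtrace (A + B) = mtrace A + mtrace B"
  by (auto simp: mtrace_def sum.distrib)

text \<open>Each diagonal entry of the congruence is the form of \<open>A\<close> at a column of
  \<open>B\<close>. This turns a trace into a sum of terms whose signs are known when
  \<open>A\<close> is positive.\<close>

lemma mtrace_congruence:
  assumes "A \<in> carrier_mat n n" "B \<in> carrier_mat n m"
  shows "mtrace (cadj B * A * B) = (\<Sum>i<m. quad_form A (col B i))"
proof -
  have "(cadj B * (A * B)) $$ (i, i) = quad_form A (col B i)" if "i < m" for i
    using assms that
    by (auto simp: quad_form_def scalar_prod_def lessThan_atLeast0 mult_mat_vec_def row_def col_def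
        intro!: sum.cong)
  moreover have "cadj B * A * B = cadj B * (A * B)"
    using assms by (simp add: assoc_mult_mat[of _ m n _ n _ m])
  ultimately show ?thesis
    using assms by (simp add: mtrace_def)
qed

section \<open>Inverses\<close>

text \<open>Once products are associated to the right, an inverse pair inside a long product appears
  exactly in this nested shape, so the rule cancels it by rewriting.\<close>

lemma mult_cancel_left_inverse:
  assumes "A * B = 1\<^sub>m d" "A \<in> carrier_mat d d" "B \<in> carrier_mat d d" "X \<in> carrier_mat d d"
  shows "A * (B * X) = (X :: 'a :: semiring_1 mat)"
  using assms by (metis assoc_mult_mat left_mult_one_mat)

text \<open>For square matrices a right inverse is also a left inverse, and two-sided inverses are
  unique.\<close>

lemma minv_eqI:
  assumes A: "A \<in> carrier_mat d d" and B: "B \<in> carrier_mat d d" and AB: "A * B = 1\<^sub>m d"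
  shows "minv d A = B"
  unfolding minv_def
proof (rule the_equality)
  show "B \<in> carrier_mat d d \<and> A * B = 1\<^sub>m d \<and> B * A = 1\<^sub>m d"
    using assms mat_mult_left_right_inverse by blast
  fix C assume C: "C \<in> carrier_mat d d \<and> A * C = 1\<^sub>m d \<and> C * A = 1\<^sub>m d"
  then show "C = B"
    using mult_cancel_left_inverse[of C A d B] A B AB by (metis right_mult_one_mat)
qed

text \<open>A nonzero kernel vector would make the quadratic form vanish, hence the determinant is
  nonzero. The inverse \<open>B\<close> satisfies \<open>cadj B * A * B = B\<close>, so it inherits
  positivity by congruence.\<close>

lemma pos_def_minv:
  assumes A: "pos_def d A"
  shows "pos_def d (minv d A)" "A * minv d A = 1\<^sub>m d" "minv d A * A = 1\<^sub>m d"
    "minv d (minv d A) = A"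
proof -
  note Ad = pos_defD[OF A]
  have "det A \<noteq> 0"
  proof
    assume "det A = 0"
    then obtain v where v: "v \<in> carrier_vec d" "v \<noteq> 0\<^sub>v d" "A *\<^sub>v v = 0\<^sub>v d"
      using det_0_iff_vec_prod_zero[OF Ad(1)] by blast
    then have "quad_form A v = 0"
      by (simp add: quad_form_def)
    then show False
      using Ad(3)[OF v(1,2)] by simp
  qed
  from det_non_zero_imp_unit[OF Ad(1) this]
  obtain B where B: "B \<in> carrier_mat d d" "A * B = 1\<^sub>m d" "B * A = 1\<^sub>m d"
    unfolding Units_def by (auto simp: ring_mat_def)
  have m: "minv d A = B"
    using minv_eqI Ad(1) B by blast
  have "cadj B * A = 1\<^sub>m d"
    using cadj_mult[OF Ad(1) B(1)] Ad(2) B(2) by simp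
  then have "cadj B * A * B = B"
    using B by simp
  then show "pos_def d (minv d A)"
    using pos_def_congruence[OF A B(1) Ad(1) B(2)] m by simp
  show "A * minv d A = 1\<^sub>m d" "minv d A * A = 1\<^sub>m d" "minv d (minv d A) = A"
    using B m minv_eqI[OF B(1) Ad(1)] by auto
qed

lemma pos_def_sandwich:
  assumes S: "pos_def d S" and A: "pos_def d A"
  shows "pos_def d (S * A * S)"
  using pos_def_congruence[OF A pos_defD(1)[OF S] _ pos_def_minv(3)[OF S]]
    pos_defD[OF S] pos_defD(1)[OF pos_def_minv(1)[OF S]] by simp

section \<open>Square roots\<close>

text \<open>With \<open>D = B - C\<close> we have \<open>B D + D C = 0\<close>, so \<open>Tr (D B D) + Tr (D C D) = 0\<close>; both traces are sums
  of values of the quadratic forms at the columns of \<open>D\<close>, hence these columns vanish.\<close>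
lemma pos_semidef_sqrt_unique:
  assumes B: "pos_semidef d B" and C: "pos_def d C" and eq: "B * B = C * C"
  shows "B = C"
proof -
  have Bd: "B \<in> carrier_mat d d" "cadj B = B" "\<And>v. v \<in> carrier_vec d \<Longrightarrow> Re (quad_form B v) \<ge> 0"
    using B by (auto simp: pos_semidef_def hermitian_def)
  note Cd = pos_defD[OF C]
  have Cs: "\<And>v. v \<in> carrier_vec d \<Longrightarrow> Re (quad_form C v) \<ge> 0"
    using pos_def_imp_semidef[OF C] by (simp add: pos_semidef_def)
  define D where "D = B - C"
  have D: "D \<in> carrier_mat d d"
    using Cd(1) unfolding D_def by (rule minus_carrier_mat)
  have Dh: "cadj D = D"
  proof (rule eq_matI)
    fix i j assume "i < dim_row D" "j < dim_col D"
    then have ij: "i < d" "j < d" using D by auto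
    have "cnj (B $$ (j, i)) = B $$ (i, j)" "cnj (C $$ (j, i)) = C $$ (i, j)"
      using ij Bd Cd by (metis cadj_index carrier_matD)+
    then show "cadj D $$ (i, j) = D $$ (i, j)"
      using ij Bd Cd by (simp add: D_def)
  qed (use D in auto)
  have "B * D = B * B - B * C" "D * C = B * C - C * C"
    using Bd Cd by (simp_all add: D_def mult_minus_distrib_mat minus_mult_distrib_mat)
  then have "B * D + D * C = 0\<^sub>m d d"
    using Bd Cd eq by (intro eq_matI) auto
  then have z: "D * (B * D) + D * (D * C) = 0\<^sub>m d d"
    using Bd Cd D by (simp flip: mult_add_distrib_mat[of D d d _ d])
  \<comment> \<open>Cyclicity moves one factor \<open>D\<close> to the right; since \<open>D\<close>
    is Hermitian, the result is a congruence of \<open>C\<close>.\<close>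
  have "mtrace (D * (D * C)) = mtrace (cadj D * C * D)"
    using D Cd Dh mtrace_comm[of D d d "D * C"] by (simp add: assoc_mult_mat[of _ d d _ d _ d])
  moreover have "mtrace (D * (B * D)) = mtrace (cadj D * B * D)"
    using D Bd Dh by (simp add: assoc_mult_mat[of _ d d _ d _ d])
  moreover have "mtrace (D * (B * D)) + mtrace (D * (D * C)) = 0"
    using mtrace_add[of "D * (B * D)" d "D * (D * C)"] D Bd(1) Cd(1) z by (simp add: mtrace_def)
  ultimately have "(\<Sum>i<d. quad_form B (col D i) + quad_form C (col D i)) = 0"
    using D Bd Cd by (simp add: mtrace_congruence sum.distrib add.commute)
  then have s: "(\<Sum>i<d. Re (quad_form B (col D i)) + Re (quad_form C (col D i))) = 0"
    by (metis (no_types, lifting) Re_sum plus_complex.sel(1) sum.cong zero_complex.sel(1))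
  have col0: "col D i = 0\<^sub>v d" if i: "i < d" for i
  proof (rule ccontr)
    assume nz: "col D i \<noteq> 0\<^sub>v d"
    have c: "col D j \<in> carrier_vec d" for j
      using D by auto
    \<comment> \<open>A zero sum of nonnegative terms has only zero terms; strict positivity of
      \<open>C\<close> then excludes a nonzero column.\<close>
    have "Re (quad_form B (col D i)) + Re (quad_form C (col D i)) = 0"
      using s i Bd(3)[OF c] Cs[OF c] by (subst (asm) sum_nonneg_eq_0_iff) auto
    then show False
      using Bd(3)[OF c[of i]] Cd(3)[OF c[of i] nz] by linarith
  qed
  have D0: "D $$ (i, j) = 0" if "i < d" "j < d" for i j
    using arg_cong[OF col0[OF that(2)], of "\<lambda>v. v $ i"] that D by simp
  show ?thesis
  proof (rule eq_matI)
    fix i j assume "i < dim_row C" "j < dim_col C"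
    then show "B $$ (i, j) = C $$ (i, j)"
      using D0[of i j] Bd Cd by (simp add: D_def)
  qed (use Bd Cd in auto)
qed

text \<open>The description in \<open>msqrt\<close> ranges over semidefinite roots. The uniqueness
  lemma compares any such root with a definite one, so a definite root settles it.\<close>

lemma msqrt_eqI:
  assumes "pos_def d B" "B * B = A"
  shows "msqrt d A = B"
  unfolding msqrt_def
  using assms pos_def_imp_semidef pos_semidef_sqrt_unique by (intro the_equality) auto

text \<open>Over the complex numbers the characteristic polynomial has a root. An eigenvector for it
  is completed to a basis, orthogonalised and normalised, with the eigenvector kept in
  front.\<close>

lemma unitary_with_eigenvector:
  fixes A :: "complex mat"
  assumes A: "A \<in> carrier_mat n n" and n: "n \<noteq> 0"
  obtains U e where "U \<in> carrier_mat n n" "cadj U * U = 1\<^sub>m n" "col (A * U) 0 = e \<cdot>\<^sub>v col U 0"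
proof -
  obtain as where as: "char_poly A = (\<Prod>a\<leftarrow>as. [:- a, 1:])" "length as = n"
    using char_poly_factorized[OF A] by blast
  then obtain e where "poly (char_poly A) e = 0"
    using n by (cases as) auto
  then have "eigenvalue A e"
    using eigenvalue_root_char_poly[OF A] by blast
  then obtain v where v: "v \<in> carrier_vec n" "v \<noteq> 0\<^sub>v n" "A *\<^sub>v v = e \<cdot>\<^sub>v v"
    using A by (auto simp: eigenvalue_def eigenvector_def)
  interpret cof_vec_space n "TYPE(complex)" .
  define ws where "ws = gram_schmidt n (basis_completion v)"
  note bc = basis_completion[OF v(1,2)]
  have ws: "set ws \<subseteq> carrier_vec n" "corthogonal ws" "length ws = n"
    using gram_schmidt_result[OF bc(2,4,5) ws_def] bc by auto
  obtain vs where bv: "basis_completion v = v # vs"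
    using bc n by (cases "basis_completion v") auto
  \<comment> \<open>Gram-Schmidt leaves its first input unchanged, so the eigenvector survives as
    \<open>ws ! 0\<close>.\<close>
  have "hd ws = v"
    using gram_schmidt_hd[OF v(1), of vs] bv by (simp add: ws_def)
  then have ws0: "ws ! 0 = v"
    using ws n by (cases ws) auto
  have wsc: "ws ! i \<in> carrier_vec n" if "i < n" for i
    using ws that by auto
  \<comment> \<open>The vectors in \<open>ws\<close> are orthogonal but not normalised;
    \<open>c i\<close> is a squared length, and division by its root gives the unit columns of
    \<open>U\<close>.\<close>
  define c where "c i = (\<Sum>k<n. (cmod (ws ! i $ k))\<^sup>2)" for i
  have ip: "(\<Sum>k<n. cnj (ws ! i $ k) * ws ! j $ k) = (if i = j then complex_of_real (c i) else 0)"
    and cpos: "c i > 0" if i: "i < n" and j: "j < n" for i j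
  proof -
    have eq: "ws ! j \<bullet>c ws ! i = (\<Sum>k<n. cnj (ws ! i $ k) * ws ! j $ k)" if "i < n" "j < n" for i j
      using wsc[THEN carrier_vecD] that
      by (auto simp: scalar_prod_def lessThan_atLeast0 mult.commute intro!: sum.cong)
    have cc: "(\<Sum>k<n. cnj (ws ! i $ k) * ws ! i $ k) = complex_of_real (c i)"
      by (simp add: c_def mult.commute[of "cnj _"] complex_norm_square[symmetric])
    show "(\<Sum>k<n. cnj (ws ! i $ k) * ws ! j $ k) = (if i = j then complex_of_real (c i) else 0)"
      using cc eq[OF i j] corthogonalD[OF ws(2), of j i] i j ws(3) by auto
    have "c i \<noteq> 0"
      using cc eq[OF i i] corthogonalD[OF ws(2), of i i] i ws(3) by auto
    moreover have "c i \<ge> 0"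
      by (simp add: c_def sum_nonneg)
    ultimately show "c i > 0" by simp
  qed
  define U where "U = mat n n (\<lambda>(k, i). ws ! i $ k / complex_of_real (sqrt (c i)))"
  have U: "U \<in> carrier_mat n n"
    by (simp add: U_def)
  have "cadj U * U = 1\<^sub>m n"
  proof (rule eq_matI)
    fix i j assume "i < dim_row (1\<^sub>m n :: complex mat)" "j < dim_col (1\<^sub>m n :: complex mat)"
    then have ij: "i < n" "j < n" by auto
    have "(cadj U * U) $$ (i, j) = (\<Sum>k<n. cnj (ws ! i $ k) * ws ! j $ k)
        / (complex_of_real (sqrt (c i)) * complex_of_real (sqrt (c j)))"
      using ij by (auto simp: U_def scalar_prod_def lessThan_atLeast0 sum_divide_distrib intro!: sum.cong)
    also have "\<dots> = (1\<^sub>m n :: complex mat) $$ (i, j)"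
      using ij ip[OF ij] cpos[of i j]
      by (auto simp flip: of_real_mult)
    finally show "(cadj U * U) $$ (i, j) = (1\<^sub>m n :: complex mat) $$ (i, j)" .
  qed (use U in auto)
  moreover have "col (A * U) 0 = e \<cdot>\<^sub>v col U 0"
  proof -
    have "col U 0 = (1 / complex_of_real (sqrt (c 0))) \<cdot>\<^sub>v v"
      using n v ws0 by (intro eq_vecI) (auto simp: U_def)
    then show ?thesis
      using n v by (simp add: col_mult2[OF A U] mult_mat_vec[OF A] smult_smult_assoc mult.commute)
  qed
  ultimately show ?thesis
    using that U by blast
qed

section \<open>Direct sums of a scalar and a matrix\<close>

lemma mult_mat_vec_index:
  "A \<in> carrier_mat n m \<Longrightarrow> v \<in> carrier_vec m \<Longrightarrow> i < n
    \<Longrightarrow> (A *\<^sub>v v) $ i = (\<Sum>j<m. A $$ (i, j) * v $ j)"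
  by (auto simp: scalar_prod_def lessThan_atLeast0 intro!: sum.cong)

definition block_diag :: "complex \<Rightarrow> complex mat \<Rightarrow> complex mat" where
  "block_diag a B = four_block_mat (mat 1 1 (\<lambda>_. a)) (0\<^sub>m 1 (dim_col B)) (0\<^sub>m (dim_row B) 1) B"

lemma block_diag_carrier [simp]:
  "B \<in> carrier_mat n n \<Longrightarrow> block_diag a B \<in> carrier_mat (Suc n) (Suc n)"
  using four_block_carrier_mat[of "mat 1 1 (\<lambda>_. a)" 1 1 B n n] by (simp add: block_diag_def)

lemma block_diag_index [simp]:
  "block_diag a B $$ (0, 0) = a"
  "j < dim_col B \<Longrightarrow> block_diag a B $$ (0, Suc j) = 0"
  "i < dim_row B \<Longrightarrow> block_diag a B $$ (Suc i, 0) = 0"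
  "i < dim_row B \<Longrightarrow> j < dim_col B \<Longrightarrow> block_diag a B $$ (Suc i, Suc j) = B $$ (i, j)"
  by (simp_all add: block_diag_def)

text \<open>Separating index 0 from successors matches the four index rules for
  \<open>block_diag\<close>.\<close>

lemma mat_SucI:
  assumes "A \<in> carrier_mat (Suc n) (Suc n)" "B \<in> carrier_mat (Suc n) (Suc n)"
    and "A $$ (0, 0) = B $$ (0, 0)"
    and "\<And>j. j < n \<Longrightarrow> A $$ (0, Suc j) = B $$ (0, Suc j)"
    and "\<And>i. i < n \<Longrightarrow> A $$ (Suc i, 0) = B $$ (Suc i, 0)"
    and "\<And>i j. i < n \<Longrightarrow> j < n \<Longrightarrow> A $$ (Suc i, Suc j) = B $$ (Suc i, Suc j)"
  shows "A = B"
proof (rule eq_matI)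
  fix i j assume "i < dim_row B" "j < dim_col B"
  then show "A $$ (i, j) = B $$ (i, j)"
    using assms by (cases i; cases j) auto
qed (use assms in auto)

lemma quad_form_block_diag:
  assumes B: "B \<in> carrier_mat n n" and v: "v \<in> carrier_vec (Suc n)"
  shows "quad_form (block_diag a B) v
    = a * (cmod (v $ 0))\<^sup>2 + quad_form B (vec n (\<lambda>i. v $ Suc i))"
proof -
  let ?w = "vec n (\<lambda>i. v $ Suc i)"
  note idx = mult_mat_vec_index[OF block_diag_carrier[OF B] v] mult_mat_vec_index[OF B, of ?w]
  have "(block_diag a B *\<^sub>v v) $ 0 = a * v $ 0"
    using B by (simp add: idx sum.lessThan_Suc_shift del: sum.lessThan_Suc)
  moreover have "(block_diag a B *\<^sub>v v) $ Suc i = (B *\<^sub>v ?w) $ i" if "i < n" for i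
    using B that by (simp add: idx sum.lessThan_Suc_shift del: sum.lessThan_Suc index_mult_mat_vec)
  ultimately show ?thesis
    using v complex_norm_square[of "v $ 0"]
    by (simp add: quad_form_def sum.lessThan_Suc_shift ac_simps
        del: sum.lessThan_Suc index_mult_mat_vec)
qed

lemma hermitian_block_diag_iff:
  assumes B: "B \<in> carrier_mat n n"
  shows "hermitian (block_diag a B) \<longleftrightarrow> a \<in> \<real> \<and> hermitian B"
proof
  assume "hermitian (block_diag a B)"
  then have h: "cnj (block_diag a B $$ (j, i)) = block_diag a B $$ (i, j)" if "i < Suc n" "j < Suc n" for i j
    using that block_diag_carrier[OF B, of a] unfolding hermitian_def
    by (metis cadj_index carrier_matD)
  have "cadj B = B"
  proof (rule eq_matI)
    fix i j assume "i < dim_row B" "j < dim_col B"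
    then show "cadj B $$ (i, j) = B $$ (i, j)"
      using h[of "Suc i" "Suc j"] B by simp
  qed (use B in auto)
  then show "a \<in> \<real> \<and> hermitian B"
    using h[of 0 0] by (simp add: hermitian_def Reals_cnj_iff)
next
  assume h: "a \<in> \<real> \<and> hermitian B"
  then have "cnj (B $$ (j, i)) = B $$ (i, j)" if "i < n" "j < n" for i j
    using that B unfolding hermitian_def by (metis cadj_index carrier_matD)
  then show "hermitian (block_diag a B)"
    unfolding hermitian_def using h B carrier_matD[OF block_diag_carrier[OF B]]
    by (intro mat_SucI[of _ n]) (auto simp: Reals_cnj_iff)
qed

lemma vec_neqI: "v $ i \<noteq> w $ i \<Longrightarrow> v \<noteq> w"
  by auto

text \<open>Vectors supported on coordinate 0, or on the remaining coordinates, test the two blocks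
  separately. Conversely, a nonzero vector has a nonzero head or a nonzero tail, and that part
  contributes strictly.\<close>

lemma pos_def_block_diag_iff:
  assumes B: "B \<in> carrier_mat n n"
  shows "pos_def (Suc n) (block_diag a B) \<longleftrightarrow> a \<in> \<real> \<and> Re a > 0 \<and> pos_def n B"
proof
  assume p: "pos_def (Suc n) (block_diag a B)"
  \<comment> \<open>\<open>?q c w\<close> prepends the entry \<open>c\<close> to the vector
    \<open>w\<close>.\<close>
  let ?q = "\<lambda>(c :: complex) w. vec (Suc n) (\<lambda>i. case i of 0 \<Rightarrow> c | Suc j \<Rightarrow> w $ j)"
  have q: "Re (quad_form (block_diag a B) (?q c w)) = Re (a * (cmod c)\<^sup>2) + Re (quad_form B w)"
    if "w \<in> carrier_vec n" for c w
  proof -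
    have "vec n (\<lambda>i. ?q c w $ Suc i) = w"
      using that by (intro eq_vecI) auto
    then show ?thesis
      by (simp add: quad_form_block_diag[OF B])
  qed
  have "?q 1 (0\<^sub>v n) \<noteq> 0\<^sub>v (Suc n)"
    by (rule vec_neqI[of _ 0]) simp
  then have "Re a > 0"
    using pos_defD(3)[OF p, of "?q 1 (0\<^sub>v n)"] q[of "0\<^sub>v n" 1] B by simp
  moreover have "Re (quad_form B w) > 0" if w: "w \<in> carrier_vec n" "w \<noteq> 0\<^sub>v n" for w
  proof -
    obtain i where "i < n" "w $ i \<noteq> 0"
      using w by (metis carrier_vecD eq_vecI index_zero_vec)
    then have "?q 0 w \<noteq> 0\<^sub>v (Suc n)"
      by (intro vec_neqI[of _ "Suc i"]) simp
    then show ?thesis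
      using pos_defD(3)[OF p, of "?q 0 w"] q[OF w(1), of 0] by simp
  qed
  ultimately show "a \<in> \<real> \<and> Re a > 0 \<and> pos_def n B"
    using p B hermitian_block_diag_iff[OF B] by (auto simp: pos_def_def)
next
  assume h: "a \<in> \<real> \<and> Re a > 0 \<and> pos_def n B"
  have "Re (quad_form (block_diag a B) v) > 0"
    if v: "v \<in> carrier_vec (Suc n)" "v \<noteq> 0\<^sub>v (Suc n)" for v
  proof -
    let ?w = "vec n (\<lambda>i. v $ Suc i)"
    have e: "Re (quad_form (block_diag a B) v) = Re a * (cmod (v $ 0))\<^sup>2 + Re (quad_form B ?w)"
      using quad_form_block_diag[OF B v(1)] by simp
    have B0: "Re (quad_form B ?w) \<ge> 0"
      using pos_def_imp_semidef[of n B] h by (simp add: pos_semidef_def)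
    show ?thesis
    proof (cases "v $ 0 = 0")
      case False
      then have "Re a * (cmod (v $ 0))\<^sup>2 > 0"
        using h by simp
      then show ?thesis
        using e B0 by linarith
    next
      case True
      obtain i where i: "i < Suc n" "v $ i \<noteq> 0"
        using v by (metis carrier_vecD eq_vecI index_zero_vec)
      then obtain j where j: "i = Suc j" "j < n"
        using True by (cases i) auto
      then have "?w \<noteq> 0\<^sub>v n"
        using i by (intro vec_neqI[of _ j]) simp
      then have "Re (quad_form B ?w) > 0"
        using h pos_defD(3)[of n B ?w] by simp
      then show ?thesis
        using e True by simp
    qed
  qed
  then show "pos_def (Suc n) (block_diag a B)"
    using h B hermitian_block_diag_iff[OF B] by (auto simp: pos_def_def)
qed

lemma block_diag_mult:
  assumes "B \<in> carrier_mat n n" "C \<in> carrier_mat n n"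
  shows "block_diag a B * block_diag b C = block_diag (a * b) (B * C)"
proof -
  have "mat 1 1 (\<lambda>_. a) * mat 1 1 (\<lambda>_. b) = mat 1 1 (\<lambda>_. a * b)"
    by (intro eq_matI) (auto simp: scalar_prod_def)
  then show ?thesis
    using assms unfolding block_diag_def
    by (subst mult_four_block_mat[where ?nr1.0 = 1 and ?n1.0 = 1 and ?n2.0 = n and ?nr2.0 = n
          and ?nc1.0 = 1 and ?nc2.0 = n]) auto
qed

text \<open>A unitary whose first column is an eigenvector splits off a \<open>1 \<times> 1\<close> block, which permits
  induction on the dimension.\<close>
lemma pos_def_sqrt_exists:
  assumes "pos_def d A"
  shows "\<exists>B. pos_def d B \<and> B * B = A"
  using assms
proof (induction d arbitrary: A)
  case 0
  \<comment> \<open>All 0 by 0 matrices coincide, so \<open>A\<close> serves as its own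
    root.\<close>
  then show ?case
    using pos_defD(1)[OF 0] by (intro exI[of _ A]) auto
next
  case (Suc n)
  note Ad = pos_defD[OF Suc.prems]
  obtain U e where U: "U \<in> carrier_mat (Suc n) (Suc n)" "cadj U * U = 1\<^sub>m (Suc n)"
    and ev: "col (A * U) 0 = e \<cdot>\<^sub>v col U 0"
    using unitary_with_eigenvector[OF Ad(1)] by auto
  have UU: "U * cadj U = 1\<^sub>m (Suc n)"
    using mat_mult_left_right_inverse[OF _ U(1) U(2)] U(1) by simp
  have Uc: "cadj U \<in> carrier_mat (Suc n) (Suc n)"
    using U by simp
  define M where "M = cadj U * A * U"
  have M: "pos_def (Suc n) M"
    unfolding M_def by (rule pos_def_congruence[OF Suc.prems U(1) Uc U(2)])
  note Md = pos_defD[OF M]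
  \<comment> \<open>By the eigenvector equation, column 0 of \<open>M\<close> is \<open>e\<close>
    times column 0 of \<open>cadj U * U\<close>, which is the identity.\<close>
  have M0: "M $$ (i, 0) = (if i = 0 then e else 0)" if i: "i < Suc n" for i
  proof -
    have "M $$ (i, 0) = row (cadj U) i \<bullet> col (A * U) 0"
      using U Ad i by (simp add: M_def assoc_mult_mat[of _ "Suc n" "Suc n" _ "Suc n" _ "Suc n"])
    also have "\<dots> = e * (cadj U * U) $$ (i, 0)"
      using U(1) i by (simp add: ev)
    finally show ?thesis
      unfolding U(2) using i by simp
  qed
  define A' where "A' = mat n n (\<lambda>(i, j). M $$ (Suc i, Suc j))"
  have A': "A' \<in> carrier_mat n n"
    by (simp add: A'_def)
  \<comment> \<open>Hermitian symmetry transfers the zeros of the first column to the first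
    row.\<close>
  have "M $$ (0, Suc j) = 0" if "j < n" for j
    using M0[of "Suc j"] that Md(1,2) cadj_index[of 0 M "Suc j"] by simp
  then have MA: "M = block_diag e A'"
    using M0 Md(1) A' by (intro mat_SucI[of _ n]) (auto simp: A'_def)
  then have e: "e \<in> \<real>" "Re e > 0" "pos_def n A'"
    using M pos_def_block_diag_iff[OF A'] by auto
  then obtain B' where B': "pos_def n B'" "B' * B' = A'"
    using Suc.IH by blast
  \<comment> \<open>The corner \<open>e\<close> is a positive real, so its ordinary root joins the
    inductive root of the lower block.\<close>
  define S where "S = block_diag (complex_of_real (sqrt (Re e))) B'"
  have S: "pos_def (Suc n) S"
    using e(2) B' pos_defD(1)[OF B'(1)] by (simp add: S_def pos_def_block_diag_iff)
  have "complex_of_real (sqrt (Re e)) * complex_of_real (sqrt (Re e)) = e"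
    using e by (simp flip: of_real_mult)
  then have SS: "S * S = M"
    using B' pos_defD(1)[OF B'(1)] by (simp add: S_def block_diag_mult MA)
  note Sd = pos_defD[OF S]
  note assoc = assoc_mult_mat[of _ "Suc n" "Suc n" _ "Suc n" _ "Suc n"]
  define B where "B = U * S * cadj U"
  have "pos_def (Suc n) B"
    using pos_def_congruence[OF S Uc U(1) UU] by (simp add: B_def)
  moreover have "B * B = A"
  proof -
    have "B * B = U * (S * (S * cadj U))"
      using U Uc Sd by (simp add: B_def assoc mult_cancel_left_inverse[OF U(2)])
    also have "S * (S * cadj U) = M * cadj U"
      using Sd Uc by (simp add: SS flip: assoc)
    also have "U * (M * cadj U) = A"
      using U Uc Ad(1) UU by (simp add: M_def assoc mult_cancel_left_inverse[OF UU])
    finally show ?thesis .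
  qed
  ultimately show ?case by blast
qed

text \<open>The definite root constructed above is the one that the description in
  \<open>msqrt\<close> picks.\<close>

lemma pos_def_msqrt:
  assumes "pos_def d A"
  shows "pos_def d (msqrt d A)" "msqrt d A * msqrt d A = A"
proof -
  obtain B where B: "pos_def d B" "B * B = A"
    using pos_def_sqrt_exists[OF assms] by blast
  then show "pos_def d (msqrt d A)" "msqrt d A * msqrt d A = A"
    unfolding msqrt_eqI[OF B] by this
qed

section \<open>Geometric means\<close>

text \<open>With \<open>S\<close> the root of \<open>A\<close>, the square of
  \<open>S * G * S\<close> is \<open>S * (G * A * G) * S\<close>. Thus \<open>S * G * S\<close> and
  \<open>S * H * S\<close> are positive roots of one matrix, and \<open>S\<close> cancels.\<close>

lemma riccati_unique:
  assumes A: "pos_def d A" and G: "pos_def d G" and H: "pos_def d H"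
    and eq: "G * A * G = H * A * H"
  shows "G = H"
proof -
  define S where "S = msqrt d A"
  have S: "pos_def d S" "S * S = A"
    using pos_def_msqrt[OF A] by (simp_all add: S_def)
  note c = pos_defD(1)[OF S(1)] pos_defD(1)[OF G] pos_defD(1)[OF H] pos_defD(1)[OF A]
    pos_defD(1)[OF pos_def_minv(1)[OF S(1)]]
  note assoc = assoc_mult_mat[of _ d d _ d _ d]
  have sq: "(S * X * S) * (S * X * S) = S * (X * A * X) * S" if "X \<in> carrier_mat d d" for X
    using c that by (simp add: assoc flip: S(2))
  have "S * G * S = S * H * S"
    using msqrt_eqI[OF pos_def_sandwich[OF S(1) G] sq[OF c(2)]]
      msqrt_eqI[OF pos_def_sandwich[OF S(1) H] sq[OF c(3)]] by (simp only: eq)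
  then have "minv d S * (S * G * S) * minv d S = minv d S * (S * H * S) * minv d S"
    by simp
  then show ?thesis
    using c by (simp add: assoc mult_cancel_left_inverse[OF pos_def_minv(3)[OF S(1)]]
        pos_def_minv(2)[OF S(1)])
qed

text \<open>This characterises the mean by a Riccati equation. Writing it as
  \<open>S * T * S\<close> with \<open>minv d A = N * N\<close>, the inner factors cancel and leave
  \<open>S * (T * T) * S\<close>, where \<open>T * T = N * B * N\<close>.\<close>

lemma pos_def_gmean:
  assumes A: "pos_def d A" and B: "pos_def d B"
  shows "pos_def d (gmean d A B)" "gmean d A B * minv d A * gmean d A B = B"
proof -
  define S where "S = msqrt d A"
  have S: "pos_def d S" "S * S = A"
    using pos_def_msqrt[OF A] by (simp_all add: S_def)
  define N where "N = minv d S"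
  have N: "pos_def d N" "S * N = 1\<^sub>m d" "N * S = 1\<^sub>m d"
    using pos_def_minv[OF S(1)] by (simp_all add: N_def)
  define T where "T = msqrt d (N * B * N)"
  have T: "pos_def d T" "T * T = N * B * N"
    using pos_def_msqrt[OF pos_def_sandwich[OF N(1) B]] by (simp_all add: T_def)
  have g: "gmean d A B = S * T * S"
    by (simp add: gmean_def S_def T_def N_def)
  then show "pos_def d (gmean d A B)"
    using pos_def_sandwich[OF S(1) T(1)] by simp
  note c = pos_defD(1)[OF S(1)] pos_defD(1)[OF N(1)] pos_defD(1)[OF T(1)] pos_defD(1)[OF B]
  note assoc = assoc_mult_mat[of _ d d _ d _ d]
  note cancel = mult_cancel_left_inverse[OF N(2)] mult_cancel_left_inverse[OF N(3)]
  have "minv d A = N * N"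
    using c by (intro minv_eqI) (simp_all add: assoc cancel N flip: S(2))
  then have "gmean d A B * minv d A * gmean d A B = S * ((T * T) * S)"
    using c by (simp add: g assoc cancel)
  also have "\<dots> = B"
    unfolding T(2) using c by (simp add: assoc cancel N)
  finally show "gmean d A B * minv d A * gmean d A B = B" .
qed

text \<open>Inverting the Riccati equation of \<open>gmean d B A\<close> shows that this mean also
  solves the equation characterising \<open>gmean d A B\<close>; uniqueness finishes.\<close>

lemma gmean_commute:
  assumes A: "pos_def d A" and B: "pos_def d B"
  shows "gmean d A B = gmean d B A"
proof (rule riccati_unique[OF pos_def_minv(1)[OF A] pos_def_gmean(1)[OF A B] pos_def_gmean(1)[OF B A]])
  define G where "G = gmean d B A"
  have G: "pos_def d G" "G * minv d B * G = A"
    unfolding G_def by (fact pos_def_gmean[OF B A])+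
  note assoc = assoc_mult_mat[of _ d d _ d _ d]
  define H where "H = minv d G"
  have H: "pos_def d H" "G * H = 1\<^sub>m d" "H * G = 1\<^sub>m d"
    using pos_def_minv[OF G(1)] by (simp_all add: H_def)
  note c = pos_defD(1)[OF G(1)] pos_defD(1)[OF H(1)] pos_defD(1)[OF B]
    pos_defD(1)[OF pos_def_minv(1)[OF B]]
  note cancel = mult_cancel_left_inverse[OF H(2)] mult_cancel_left_inverse[OF H(3)]
    mult_cancel_left_inverse[OF pos_def_minv(2)[OF B]]
    mult_cancel_left_inverse[OF pos_def_minv(3)[OF B]]
  have "minv d A = H * B * H"
    using c by (intro minv_eqI) (simp_all add: assoc cancel H flip: G(2))
  then have "G * minv d A * G = B"
    using c by (simp add: assoc cancel H)
  then show "gmean d A B * minv d A * gmean d A B = gmean d B A * minv d A * gmean d B A"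
    by (simp only: G_def pos_def_gmean[OF A B])
qed

section \<open>The generalized fidelity\<close>

text \<open>The pair \<open>X\<close>, \<open>Y\<close> is \<open>R\<inverse> # P\<close>, \<open>R\<inverse> # Q\<close>.\<close>
lemma gen_fid_riccati:
  assumes R: "pos_def d R" and X: "pos_def d X" and Y: "pos_def d Y"
  shows "gen_fid d R (X * R * X) (Y * R * Y) = mtrace (X * Y * R)"
proof -
  define S where "S = msqrt d R"
  have S: "pos_def d S" "S * S = R"
    using pos_def_msqrt[OF R] by (simp_all add: S_def)
  define N where "N = minv d S"
  have N: "pos_def d N" "S * N = 1\<^sub>m d" "N * S = 1\<^sub>m d"
    using pos_def_minv[OF S(1)] by (simp_all add: N_def)
  note c = pos_defD(1)[OF S(1)] pos_defD(1)[OF N(1)] pos_defD(1)[OF X] pos_defD(1)[OF Y]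
  note assoc = assoc_mult_mat[of _ d d _ d _ d]
  note cancel = mult_cancel_left_inverse[OF N(2)] mult_cancel_left_inverse[OF N(3)]
  \<comment> \<open>Splitting \<open>R\<close> as \<open>S * S\<close> makes the radicand the square
    of \<open>S * Z * S\<close>.\<close>
  have sq: "msqrt d (S * (Z * R * Z) * S) = S * Z * S" if Z: "pos_def d Z" for Z
    using c pos_defD(1)[OF Z]
    by (intro msqrt_eqI pos_def_sandwich S Z) (simp add: assoc flip: S(2))
  have inv: "minv d R = N * N"
    using c by (intro minv_eqI) (simp_all add: assoc cancel N flip: S(2))
  have "gen_fid d R (X * R * X) (Y * R * Y) = mtrace (S * X * S * (N * N) * (S * Y * S))"
    unfolding gen_fid_def S_def[symmetric] sq[OF X] sq[OF Y] inv ..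
  also have "S * X * S * (N * N) * (S * Y * S) = S * (X * Y * S)"
    using c by (simp add: assoc cancel)
  also have "mtrace \<dots> = mtrace (X * Y * S * S)"
    using c by (intro mtrace_comm) auto
  also have "X * Y * S * S = X * Y * R"
    using c by (simp add: assoc flip: S(2))
  finally show ?thesis .
qed

text \<open>The form is a convex combination of the squared norm and the form of \<open>G\<close>,
  both positive at nonzero vectors. For \<open>t = 0\<close> the norm term is strict, otherwise the
  term of \<open>G\<close> is.\<close>

lemma pos_def_convex_one:
  assumes G: "pos_def d G" and t: "0 \<le> t" "t \<le> 1"
  shows "pos_def d (complex_of_real (1 - t) \<cdot>\<^sub>m 1\<^sub>m d + complex_of_real t \<cdot>\<^sub>m G)"
proof -
  let ?M = "complex_of_real (1 - t) \<cdot>\<^sub>m 1\<^sub>m d + complex_of_real t \<cdot>\<^sub>m G"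
  note Gd = pos_defD[OF G]
  have Gh: "cnj (G $$ (j, i)) = G $$ (i, j)" if "i < d" "j < d" for i j
    using that Gd(1,2) by (metis cadj_index carrier_matD)
  have "cadj ?M = ?M"
    using Gd(1) Gh by (intro eq_matI) auto
  moreover have "Re (quad_form ?M v) > 0" if v: "v \<in> carrier_vec d" "v \<noteq> 0\<^sub>v d" for v
  proof -
    have eq: "quad_form ?M v
      = complex_of_real (1 - t) * (conjugate v \<bullet> v) + complex_of_real t * quad_form G v"
    proof -
      have "?M *\<^sub>v v = complex_of_real (1 - t) \<cdot>\<^sub>v v + complex_of_real t \<cdot>\<^sub>v (G *\<^sub>v v)"
        using Gd(1) v(1) by (intro eq_vecI) (auto simp: add_scalar_prod_distrib[of _ d])
      then show ?thesis
        using Gd(1) v(1) by (simp add: quad_form_eq_scalar_prod scalar_prod_add_distrib[of _ d])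
    qed
    have "v \<bullet>c v > 0"
      using v by simp
    then have 1: "Re (conjugate v \<bullet> v) > 0"
      using conjugate_vec_sprod_comm[OF v(1) v(1)] by (simp add: less_complex_def)
    have 2: "Re (quad_form G v) > 0"
      using Gd(3) v by blast
    have "(1 - t) * Re (conjugate v \<bullet> v) + t * Re (quad_form G v) > 0"
    proof (cases "t = 0")
      case False
      then have "t * Re (quad_form G v) > 0" using t 2 by simp
      moreover have "(1 - t) * Re (conjugate v \<bullet> v) \<ge> 0" using t 1 by simp
      ultimately show ?thesis by linarith
    qed (use 1 in simp)
    then show ?thesis
      unfolding eq by simp
  qed
  ultimately show ?thesis
    using Gd(1) by (auto simp: pos_def_def hermitian_def)
qed

theorem mainTheorem7:
  fixes d :: nat and P Q :: "complex mat" and t :: real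
  assumes "pos_def d P" and "pos_def d Q" and "0 \<le> t" and "t \<le> 1"
  shows "gen_fid d (minv d (bw_geod d (minv d P) Q t)) P Q
       = gen_fid d (minv d (bw_geod d (minv d Q) P t)) P Q"
proof -
  note P = assms(1) and Q = assms(2)
  note assoc = assoc_mult_mat[of _ d d _ d _ d]
  define M where "M = complex_of_real (1 - t) \<cdot>\<^sub>m 1\<^sub>m d + complex_of_real t \<cdot>\<^sub>m gmean d P Q"
  have M: "pos_def d M"
    unfolding M_def by (rule pos_def_convex_one[OF pos_def_gmean(1)[OF P Q] assms(3,4)])
  define N where "N = minv d M"
  have N: "pos_def d N" "M * N = 1\<^sub>m d" "N * M = 1\<^sub>m d"
    using pos_def_minv[OF M] by (simp_all add: N_def)
  \<comment> \<open>The mean inside \<open>bw_geod\<close> inverts its base point again, giving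
    \<open>gmean d P Q\<close> and \<open>gmean d Q P\<close>, which agree.\<close>
  have geod: "bw_geod d (minv d P) Q t = M * minv d P * M" "bw_geod d (minv d Q) P t = M * minv d Q * M"
    by (simp_all add: bw_geod_def Let_def M_def pos_def_minv(4)[OF P] pos_def_minv(4)[OF Q]
        gmean_commute[OF Q P])
  have inv: "minv d (M * minv d A * M) = N * A * N" if A: "pos_def d A" for A
  proof -
    note c = pos_defD(1)[OF M] pos_defD(1)[OF N(1)] pos_defD(1)[OF A]
      pos_defD(1)[OF pos_def_minv(1)[OF A]]
    show ?thesis
      using c by (intro minv_eqI) (simp_all add: assoc N mult_cancel_left_inverse[OF N(2)]
          mult_cancel_left_inverse[OF N(3)] mult_cancel_left_inverse[OF pos_def_minv(3)[OF A]])
  qed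
  define R1 R2 where "R1 = N * P * N" and "R2 = N * Q * N"
  have R: "pos_def d R1" "pos_def d R2"
    unfolding R1_def R2_def by (rule pos_def_sandwich[OF N(1)]; fact)+
  \<comment> \<open>The double inverse of \<open>R2\<close> turns the Riccati equation of this mean
    into \<open>X * R2 * X = P\<close>.\<close>
  define X where "X = gmean d (minv d R2) P"
  have X: "pos_def d X" "X * R2 * X = P"
    using pos_def_gmean[OF pos_def_minv(1)[OF R(2)] P]
    by (simp_all only: X_def pos_def_minv(4)[OF R(2)])
  define Z where "Z = minv d X"
  have Z: "pos_def d Z" "X * Z = 1\<^sub>m d" "Z * X = 1\<^sub>m d"
    using pos_def_minv[OF X(1)] by (simp_all add: Z_def)
  note c = pos_defD(1)[OF M] pos_defD(1)[OF N(1)] pos_defD(1)[OF P] pos_defD(1)[OF Q]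
    pos_defD(1)[OF X(1)] pos_defD(1)[OF Z(1)] pos_defD(1)[OF R(1)] pos_defD(1)[OF R(2)]
  note cancel = mult_cancel_left_inverse[OF N(2)] mult_cancel_left_inverse[OF N(3)]
    mult_cancel_left_inverse[OF Z(2)] mult_cancel_left_inverse[OF Z(3)]
  \<comment> \<open>In \<open>Y * R1 * Y\<close> the inner \<open>M\<close> and \<open>N\<close>
    cancel, leaving \<open>M * (Z * P * Z) * M = M * R2 * M = Q\<close>.\<close>
  define Y where "Y = M * Z * M"
  have Y: "pos_def d Y"
    unfolding Y_def by (rule pos_def_sandwich[OF M Z(1)])
  have ZP: "Z * P = R2 * X"
    using c by (simp add: assoc cancel Z flip: X(2))
  have MRM: "M * R1 * M = P" "M * R2 * M = Q"
    using c by (simp_all add: R1_def R2_def assoc cancel N)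
  have "Y * R1 * Y = M * (Z * P * Z) * M"
    using c by (simp add: Y_def R1_def assoc cancel)
  also have "Z * P * Z = R2"
    unfolding ZP using c by (simp add: assoc Z)
  finally have YRY: "Y * R1 * Y = Q"
    using MRM by simp
  \<comment> \<open>The Riccati pair for \<open>R1\<close> is \<open>M\<close>, \<open>Y\<close>;
    the one for \<open>R2\<close>, reached at the end, is \<open>X\<close>,
    \<open>M\<close>.\<close>
  have "gen_fid d R1 P Q = mtrace (M * Y * R1)"
    using gen_fid_riccati[OF R(1) M Y] by (simp add: MRM YRY)
  also have "M * Y * R1 = M * (M * (Z * P) * N)"
    using c by (simp add: Y_def R1_def assoc cancel)
  \<comment> \<open>Moving the leading \<open>M\<close> to the end cancels \<open>N\<close>; a
    second rotation then brings \<open>X\<close> to the front.\<close>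
  also have "mtrace \<dots> = mtrace (M * (R2 * X) * N * M)"
    unfolding ZP using c by (intro mtrace_comm) auto
  also have "M * (R2 * X) * N * M = (M * R2) * X"
    using c by (simp add: assoc N)
  also have "mtrace \<dots> = mtrace (X * (M * R2))"
    using c by (intro mtrace_comm) auto
  also have "\<dots> = gen_fid d R2 P Q"
    using gen_fid_riccati[OF R(2) X(1) M] c by (simp add: MRM X(2) assoc)
  finally show ?thesis
    unfolding geod inv[OF P] inv[OF Q] R1_def R2_def .
qed

end
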